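(* Let $m\in\mathbb{N}$, let $\alpha_j,\beta_j,\gamma,b,c\in\mathbb{C}$ $(j=1,\dots,m)$ and let $\kappa>0$ be real, with $\sum_{j=1}^m\Re(\alpha_j)>\max\{0,\kappa-1\}$, $\Re(\beta_j)>0$ for all $j$, and $\Re(\gamma)>0$. Let $\lambda,\delta\in\mathbb{C}$ with $\Re(\lambda)>0$ and $\Re(\delta)>0$. Then for every $x>0$, $$\left(D_{0+}^{\lambda}\left\{t^{\delta-1}\mathcal{J}_{(\beta_j)_m,\kappa,b}^{(\alpha_j)_m,\gamma,c}(t)\right\}\right)(x)=\frac{x^{\delta-\lambda-1}}{\Gamma(\gamma)}\;{}_2\Psi_{m+1}\left[\begin{array}{c}(\gamma,\kappa),(\delta,1)\\ \left(\beta_j+\frac{b+1}{2},\alpha_j\right)_{j=1}^m,(\delta-\lambda,1)\end{array}\Big|\;cx\right].$$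
   Context: The generalized multiindex Bessel function is $$\mathcal{J}_{(\beta_j)_m,\kappa,b}^{(\alpha_j)_m,\gamma,c}[z]=\sum_{n=0}^\infty\frac{c^n(\gamma)_{\kappa n}}{\prod_{j=1}^m\Gamma\left(\alpha_jn+\beta_j+\frac{b+1}{2}\right)}\frac{z^n}{n!},\qquad (\gamma)_{\nu}=\frac{\Gamma(\gamma+\nu)}{\Gamma(\gamma)}.$$ The Fox–Wright function is given by the series $${}_p\Psi_q\left[\begin{array}{c}(a_1,A_1),\dots,(a_p,A_p)\\(b_1,B_1),\dots,(b_q,B_q)\end{array}\Big|\;z\right]=\sum_{n=0}^\infty\frac{\Gamma(a_1+A_1n)\cdots\Gamma(a_p+A_pn)}{\Gamma(b_1+B_1n)\cdots\Gamma(b_q+B_qn)}\frac{z^n}{n!},$$ where some of the $B_j$ may be complex (here $B_j=\alpha_j$). Throughout, $1/\Gamma$ is the entire reciprocal Gamma function, with value $0$ at the poles of $\Gamma$. The notation $\left(\beta_j+\frac{b+1}{2},\alpha_j\right)_{j=1}^m$ stands for the list of the $m$ pairs $\left(\beta_j+\frac{b+1}{2},\alpha_j\right)$. For $\Re(\mu)>0$ and $x>0$, $(I_{0+}^\mu f)(x)=\frac{1}{\Gamma(\mu)}\int_0^x\frac{f(t)}{(x-t)^{1-\mu}}\,dt$. The left-sided Riemann–Liouville fractional derivative is, for $\Re(\lambda)>0$ and $x>0$, $$(D_{0+}^\lambda f)(x)=\left(\frac{d}{dx}\right)^{[\Re(\lambda)]+1}\left(I_{0+}^{1-\lambda+[\Re(\lambda)]}f\right)(x),$$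 where $[\Re(\lambda)]$ is the integral part of $\Re(\lambda)$. *)

theory Defs
  imports "HOL-Analysis.Analysis"
begin

definition gen_pochhammer :: "complex \<Rightarrow> complex \<Rightarrow> complex" where
  "gen_pochhammer \<gamma> \<nu> = Gamma (\<gamma> + \<nu>) / Gamma \<gamma>"

text \<open>The index families \<open>\<alpha>\<close> and \<open>\<beta>\<close> are only used at the indices \<open>1, \<dots>, m\<close>.  Factors
  \<open>1 / \<Gamma>\<close> that may be evaluated at poles of \<open>\<Gamma>\<close> are written with the entire function
  \<^const>\<open>rGamma\<close>.\<close>

definition multiindex_bessel ::
  "nat \<Rightarrow> (nat \<Rightarrow> complex) \<Rightarrow> (nat \<Rightarrow> complex) \<Rightarrow> complex \<Rightarrow> complex \<Rightarrow> complex \<Rightarrow> complex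
    \<Rightarrow> complex \<Rightarrow> complex" where
  "multiindex_bessel m \<alpha> \<beta> \<kappa> b \<gamma> c z =
    (\<Sum>n. c ^ n * gen_pochhammer \<gamma> (\<kappa> * of_nat n)
          * (\<Prod>j=1..m. rGamma (\<alpha> j * of_nat n + \<beta> j + (b + 1) / 2)) * (z ^ n / fact n))"

definition fox_wright ::
  "(complex \<times> complex) list \<Rightarrow> (complex \<times> complex) list \<Rightarrow> complex \<Rightarrow> complex" where
  "fox_wright ps qs z =
    (\<Sum>n. (\<Prod>(a, A)\<leftarrow>ps. Gamma (a + A * of_nat n))
          * (\<Prod>(b, B)\<leftarrow>qs. rGamma (b + B * of_nat n)) * (z ^ n / fact n))"

definition RL_integral :: "complex \<Rightarrow> (real \<Rightarrow> complex) \<Rightarrow> real \<Rightarrow> complex" where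
  "RL_integral \<mu> f x =
    1 / Gamma \<mu> * (LINT t:{0<..<x}|lebesgue. f t / of_real (x - t) powr (1 - \<mu>))"

text \<open>The iterated derivative is that of a complex-valued function of a real variable, hence
  \<^const>\<open>vector_derivative\<close> rather than \<^const>\<open>deriv\<close>.\<close>

definition RL_derivative :: "complex \<Rightarrow> (real \<Rightarrow> complex) \<Rightarrow> real \<Rightarrow> complex" where
  "RL_derivative \<nu> f =
    ((\<lambda>g x. vector_derivative g (at x)) ^^ (nat \<lfloor>Re \<nu>\<rfloor> + 1))
      (RL_integral (1 - \<nu> + of_int \<lfloor>Re \<nu>\<rfloor>) f)"

end

theory Submission
  imports Defs "HOL-Real_Asymp.Real_Asymp"
begin

text \<open>
  The fractional integral of order \<open>\<mu> = 1 - \<nu> + N\<close>, \<open>N = \<lfloor>Re \<nu>\<rfloor>\<close>, acts termwise by the complex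
  Beta integral and turns \<open>t\<close>-powers into \<open>x powr (\<delta> + \<mu> - 1) * \<Sum> d\<^sub>n x\<^sup>n / \<Gamma>(\<delta> + \<mu> + n)\<close>.  Each
  derivative lowers the exponent and, since \<open>p / \<Gamma>(p + 1) = 1 / \<Gamma>(p)\<close>, the argument of the
  reciprocal Gamma factor by one, so that \<open>N + 1\<close> of them give the Fox-Wright series.

  Termwise operations are justified because all series involved are entire.  As the \<open>\<alpha>\<^sub>j\<close> may be
  arbitrary complex numbers, this needs a bound for \<open>1 / \<Gamma>\<close> along every complex ray: up to a
  factor \<open>K ^ n\<close>, \<open>\<bar>1 / \<Gamma>(a n + b)\<bar>\<close> is at most \<open>n powr (- n Re a)\<close>.  The condition on
  \<open>\<Sum> Re \<alpha>\<^sub>j\<close> then makes the coefficients decay superexponentially.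
\<close>

subsection \<open>Growth of the Gamma function\<close>

text \<open>Euler's integral with the norm moved inside: \<open>t powr (z - 1)\<close> has norm
  \<open>t powr (Re z - 1)\<close> for \<open>t > 0\<close>.\<close>

lemma norm_Gamma_le_Gamma_Re:
  assumes "Re z > 0"
  shows "norm (Gamma z) \<le> Gamma (Re z)"
proof -
  let ?f = "\<lambda>t. of_real t powr (z - 1) / of_real (exp t)"
  let ?g = "\<lambda>t. t powr (Re z - 1) / exp t"
  have f: "(?f has_integral Gamma z) {0..}" and g: "(?g has_integral Gamma (Re z)) {0..}"
    using assms by (rule Gamma_integral_complex, intro Gamma_integral_real)
  have "norm (integral {0..} ?f) \<le> integral {0..} ?g"
    by (rule integral_norm_bound_integral)
       (use f g in \<open>auto simp: norm_divide norm_powr_real_powr has_integral_iff\<close>)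
  then show ?thesis
    using f g by (simp add: has_integral_iff)
qed

text \<open>An induction tailored to the functional equation of Gamma: finitely many unit shifts to
  the left bring any point with \<open>Re z \<ge> 1\<close> into the strip. The auxiliary
  \<open>n\<close> bounds the number of shifts.\<close>

lemma half_plane_shift_induct [consumes 1, case_names strip shift]:
  fixes z :: complex
  assumes "Re z \<ge> 1"
    and strip: "\<And>z. 1 \<le> Re z \<Longrightarrow> Re z \<le> 2 \<Longrightarrow> P z"
    and shift: "\<And>z. 1 \<le> Re z \<Longrightarrow> P z \<Longrightarrow> P (z + 1)"
  shows "P z"
proof -
  have "P z" if "1 \<le> Re z" "Re z \<le> 2 + real n" for n z
    using that
  proof (induction n arbitrary: z)
    case 0
    then show ?case using strip by simp
  next
    case (Suc n)
    show ?case
    proof (cases "Re z \<le> 2")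
      case True
      then show ?thesis using strip Suc.prems by simp
    next
      case False
      then have "P (z - 1 + 1)"
        using Suc.prems by (intro shift Suc.IH) auto
      then show ?thesis by simp
    qed
  qed
  moreover obtain n where "Re z \<le> 2 + real n"
    using real_arch_simple[of "Re z - 2"] by (auto simp: algebra_simps)
  ultimately show ?thesis using assms(1) by blast
qed

text \<open>A crude Stirling bound: compactness on \<open>[1, 2]\<close>, after which the factor
  \<open>x\<close> from the functional equation is absorbed through
  \<open>x * ln x + ln x = (x + 1) * ln x \<le> (x + 1) * ln (x + 1)\<close>.\<close>

lemma Gamma_real_upper_bound:
  "\<exists>C>0. \<forall>x\<ge>1. Gamma (x::real) \<le> C * exp (x * ln x)"
proof -
  have "compact (Gamma ` {1..2::real})"
    by (intro compact_continuous_image continuous_on_Gamma) (auto elim!: nonpos_Ints_cases)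
  then obtain C where C: "C > 0" "\<And>x. x \<in> {1..2} \<Longrightarrow> norm (Gamma (x::real)) \<le> C"
    using bounded_pos[of "Gamma ` {1..2::real}"] compact_imp_bounded by blast
  have "Gamma x \<le> C * exp (x * ln x)" if "x \<ge> 1" for x
  proof -
    \<comment> \<open>The induction rule runs over complex numbers, so \<open>x\<close> is written
      as the real part of \<open>of_real x\<close>.\<close>
    have "Re (of_real x) \<ge> 1" using that by simp
    then have "Gamma (Re (of_real x)) \<le> C * exp (Re (of_real x) * ln (Re (of_real x)))"
    proof (induction rule: half_plane_shift_induct)
      case (strip z)
      then have "Gamma (Re z) \<le> C * 1" using C(2)[of "Re z"] by simp
      also have "\<dots> \<le> C * exp (Re z * ln (Re z))"
        using C(1) strip by (intro mult_left_mono) auto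
      finally show ?case .
    next
      case (shift z)
      define x where "x = Re z"
      have x: "x \<ge> 1" using shift by (simp add: x_def)
      have "Gamma (x + 1) = x * Gamma x"
        using x by (intro Gamma_plus1) (auto elim!: nonpos_Ints_cases)
      also have "\<dots> \<le> x * (C * exp (x * ln x))"
        using x shift by (intro mult_left_mono) (auto simp: x_def)
      also have "\<dots> = C * exp ((x + 1) * ln x)"
        using x by (simp add: algebra_simps exp_add)
      also have "\<dots> \<le> C * exp ((x + 1) * ln (x + 1))"
        using x C(1) by (intro mult_left_mono) (auto intro!: mult_left_mono)
      finally show ?case by (simp add: x_def)
    qed
    then show ?thesis by simp
  qed
  then show ?thesis using C(1) by blast
qed

section \<open>Upper bounds for the reciprocal Gamma function\<close>

text \<open>The reflection formula turns \<open>1 / \<Gamma>(z)\<close> into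
  \<open>\<Gamma>(1 - z) * sin (pi * z) / pi\<close>. Here \<open>1 - z\<close> has positive real
  part, the sine accounts for the exponential, and \<open>1 / pi \<le> 1\<close> is dropped.\<close>

lemma norm_rGamma_reflection_le:
  assumes "Re z < 1"
  shows "norm (rGamma z) \<le> Gamma (1 - Re z) * exp (pi * \<bar>Im z\<bar>)"
proof -
  have "1 - z \<notin> \<int>\<^sub>\<le>\<^sub>0"
    using assms by (auto elim!: nonpos_Ints_cases simp: complex_eq_iff)
  then have "rGamma z = Gamma (1 - z) * sin (of_real pi * z) / of_real pi"
    using rGamma_reflection_complex[of z]
    by (simp add: Gamma_def field_simps rGamma_eq_zero_iff)
  then have "norm (rGamma z) = norm (Gamma (1 - z)) * norm (sin (of_real pi * z)) / pi"
    by (simp add: norm_mult norm_divide)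
  also have "\<dots> \<le> norm (Gamma (1 - z)) * norm (sin (of_real pi * z))"
    using pi_ge_two by (intro divide_left_mono[of 1 pi, THEN order_trans]) auto
  also have "\<dots> \<le> Gamma (1 - Re z) * exp \<bar>Im (of_real pi * z)\<bar>"
    using assms norm_Gamma_le_Gamma_Re[of "1 - z"] cmod_sin_le_exp[of 1 "of_real pi * z"]
    by (intro mult_mono) (auto intro!: Gamma_real_nonneg)
  finally show ?thesis by (simp add: abs_mult)
qed

text \<open>The part of the strip with \<open>\<bar>Im z\<bar> \<le> 1\<close> is a compact
  rectangle. Elsewhere \<open>z\<close> is shifted left into the range of the reflection bound, and
  the factors this produces have norm at least 1.\<close>

lemma norm_rGamma_strip_bound:
  "\<exists>C>0. \<forall>z. 1 \<le> Re z \<longrightarrow> Re z \<le> 2 \<longrightarrow> norm (rGamma z) \<le> C * exp (pi * \<bar>Im z\<bar>)"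
proof -
  obtain A where A: "A > 0" "\<And>x::real. x \<ge> 1 \<Longrightarrow> Gamma x \<le> A * exp (x * ln x)"
    using Gamma_real_upper_bound by blast
  define K where "K = cbox (Complex 1 (-1)) (Complex 2 1)"
  have "compact (rGamma ` K)"
    unfolding K_def by (intro compact_continuous_image continuous_on_rGamma compact_cbox)
  then obtain B where B: "B > 0" "\<And>z. z \<in> K \<Longrightarrow> norm (rGamma z) \<le> B"
    using bounded_pos[of "rGamma ` K"] compact_imp_bounded by blast
  \<comment> \<open>The second entry bounds \<open>Gamma (3 - Re z)\<close>, whose argument lies
    between 1 and 2.\<close>
  define C where "C = max B (A * exp (2 * ln 2))"
  have "norm (rGamma z) \<le> C * exp (pi * \<bar>Im z\<bar>)" if z: "1 \<le> Re z" "Re z \<le> 2" for z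
  proof (cases "\<bar>Im z\<bar> \<le> 1")
    case True
    then have "norm (rGamma z) \<le> B"
      using z by (intro B) (auto simp: K_def in_cbox_complex_iff)
    also have "\<dots> \<le> C * 1" by (simp add: C_def)
    also have "\<dots> \<le> C * exp (pi * \<bar>Im z\<bar>)"
      using B(1) by (intro mult_left_mono) (auto simp: C_def)
    finally show ?thesis .
  next
    case False
    \<comment> \<open>Two shifts are made because a single one would take \<open>Re z = 2\<close> to
      real part 1, which the reflection bound excludes.\<close>
    have *: "rGamma (z - 2) = (z - 2) * ((z - 1) * rGamma z)"
      using rGamma_plus1[of "z - 2"] rGamma_plus1[of "z - 1"] by (simp add: algebra_simps)
    have "1 \<le> norm (z - 2)" "1 \<le> norm (z - 1)"
      using False abs_Im_le_cmod[of "z - 2"] abs_Im_le_cmod[of "z - 1"] by auto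
    then have "1 * (1 * norm (rGamma z)) \<le> norm (z - 2) * (norm (z - 1) * norm (rGamma z))"
      by (intro mult_mono) auto
    also have "\<dots> = norm (rGamma (z - 2))"
      by (simp add: * norm_mult)
    also have "\<dots> \<le> Gamma (1 - Re (z - 2)) * exp (pi * \<bar>Im (z - 2)\<bar>)"
      using z by (intro norm_rGamma_reflection_le) auto
    also have "\<dots> = Gamma (3 - Re z) * exp (pi * \<bar>Im z\<bar>)" by simp
    also have "Gamma (3 - Re z) \<le> A * exp ((3 - Re z) * ln (3 - Re z))"
      using z by (intro A) auto
    also have "\<dots> \<le> A * exp (2 * ln 2)"
      using z A(1) by (intro mult_left_mono) (auto intro!: mult_mono)
    also have "\<dots> \<le> C" by (simp add: C_def)
    finally show ?thesis by simp
  qed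
  moreover have "C > 0" using B(1) by (simp add: C_def)
  ultimately show ?thesis by blast
qed

text \<open>The right-hand side \<open>h(z)\<close> satisfies \<open>h(z) / Re z \<le> h(z + 1)\<close>, so it propagates from the strip; the factor
  \<open>exp (2 * Re z)\<close> pays for \<open>(x + 1) * ln (1 + 1 / x) \<le> 2\<close>.\<close>

lemma norm_rGamma_half_plane_bound:
  "\<exists>C>0. \<forall>z. 1 \<le> Re z \<longrightarrow> norm (rGamma z) \<le> C * exp (pi * \<bar>Im z\<bar> - Re z * ln (Re z) + 2 * Re z)"
proof -
  obtain C where C: "C > 0"
    "\<And>z. 1 \<le> Re z \<Longrightarrow> Re z \<le> 2 \<Longrightarrow> norm (rGamma z) \<le> C * exp (pi * \<bar>Im z\<bar>)"
    using norm_rGamma_strip_bound by blast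
  have "norm (rGamma z) \<le> C * exp (pi * \<bar>Im z\<bar> - Re z * ln (Re z) + 2 * Re z)" if "1 \<le> Re z" for z
    using that
  proof (induction rule: half_plane_shift_induct)
    case (strip z)
    have "Re z * ln (Re z) \<le> Re z * 2"
      using strip ln_le_minus_one[of "Re z"] by (intro mult_left_mono) auto
    then have "C * exp (pi * \<bar>Im z\<bar>) \<le> C * exp (pi * \<bar>Im z\<bar> - Re z * ln (Re z) + 2 * Re z)"
      using C(1) by simp
    then show ?case using C(2)[of z] strip by linarith
  next
    case (shift z)
    define x where "x = Re z"
    have x: "x \<ge> 1" using shift by (simp add: x_def)
    have "x + 1 = x * (1 + 1 / x)" using x by (simp add: field_simps)
    also have "ln \<dots> = ln x + ln (1 + 1 / x)"
      using x by (intro ln_mult_pos) (auto intro: add_pos_pos)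
    finally have "(x + 1) * ln (x + 1) = (x + 1) * (ln x + ln (1 + 1 / x))" by simp
    also have "\<dots> \<le> (x + 1) * (ln x + 1 / x)"
      using x ln_add_one_self_le_self[of "1 / x"] by (intro mult_left_mono) auto
    also have "\<dots> \<le> (x + 1) * ln x + 2"
      using x by (simp add: field_simps)
    finally have step: "- x * ln x + 2 * x - ln x \<le> - (x + 1) * ln (x + 1) + 2 * (x + 1)"
      by (simp add: algebra_simps)
    \<comment> \<open>The recurrence divides by \<open>z\<close>, and
      \<open>norm z \<ge> x\<close>.\<close>
    have "x * norm (rGamma (z + 1)) \<le> norm (z * rGamma (z + 1))"
      using complex_Re_le_cmod[of z] by (auto simp: norm_mult x_def intro!: mult_right_mono)
    also have "\<dots> \<le> C * exp (pi * \<bar>Im z\<bar> - x * ln x + 2 * x)"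
      using shift by (simp add: rGamma_plus1 x_def)
    finally have "norm (rGamma (z + 1)) \<le> C * exp (pi * \<bar>Im z\<bar> - x * ln x + 2 * x) / x"
      using x by (simp add: field_simps)
    also have "\<dots> = C * exp (pi * \<bar>Im z\<bar> + (- x * ln x + 2 * x - ln x))"
      using x by (simp add: exp_diff exp_add exp_minus field_simps)
    also have "\<dots> \<le> C * exp (pi * \<bar>Im z\<bar> + (- (x + 1) * ln (x + 1) + 2 * (x + 1)))"
      using C(1) step by simp
    finally show ?case by (simp add: x_def algebra_simps)
  qed
  then show ?thesis using C(1) by blast
qed

subsection \<open>Growth of Gamma quotients along arithmetic progressions\<close>

text \<open>An upper bound \<open>K ^ n * n powr (s * n)\<close> with \<open>K = exp L\<close>, that
  is, \<open>(n!) powr s\<close> up to geometric factors. The exponent \<open>s\<close> adds up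
  under products, while \<open>L\<close> is immaterial for convergence when
  \<open>s < 0\<close>.\<close>

definition factorial_growth :: "(nat \<Rightarrow> complex) \<Rightarrow> real \<Rightarrow> bool" where
  "factorial_growth f s \<longleftrightarrow>
     (\<exists>L. \<forall>\<^sub>F n in sequentially. norm (f n) \<le> exp (real n * (L + s * ln (real n))))"

lemma factorial_growthI:
  assumes "C > 0" "\<forall>\<^sub>F n in sequentially. norm (f n) \<le> C * exp (real n * (L + s * ln (real n)))"
  shows "factorial_growth f s"
  unfolding factorial_growth_def
proof (intro exI)
  show "\<forall>\<^sub>F n in sequentially. norm (f n) \<le> exp (real n * (L + \<bar>ln C\<bar> + s * ln (real n)))"
    using assms(2) eventually_gt_at_top[of 0]
  proof eventually_elim
    case (elim n)
    \<comment> \<open>A constant factor is absorbed into the geometric one, since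
      \<open>ln C \<le> n * \<bar>ln C\<bar>\<close> for \<open>n \<ge> 1\<close>.\<close>
    have "1 * \<bar>ln C\<bar> \<le> real n * \<bar>ln C\<bar>"
      using elim by (intro mult_right_mono) auto
    then have "ln C \<le> real n * \<bar>ln C\<bar>" by linarith
    then have "exp (ln C + real n * (L + s * ln (real n))) \<le> exp (real n * (L + \<bar>ln C\<bar> + s * ln (real n)))"
      by (simp add: algebra_simps)
    then show ?case using elim assms(1) by (simp add: exp_add)
  qed
qed

lemma factorial_growth_mult:
  assumes "factorial_growth f s" "factorial_growth g t"
  shows "factorial_growth (\<lambda>n. f n * g n) (s + t)"
proof -
  obtain L M where
    "\<forall>\<^sub>F n in sequentially. norm (f n) \<le> exp (real n * (L + s * ln (real n)))"
    "\<forall>\<^sub>F n in sequentially. norm (g n) \<le> exp (real n * (M + t * ln (real n)))"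
    using assms by (auto simp: factorial_growth_def)
  then have "\<forall>\<^sub>F n in sequentially. norm (f n * g n) \<le> exp (real n * ((L + M) + (s + t) * ln (real n)))"
  proof eventually_elim
    case (elim n)
    then have "norm (f n) * norm (g n) \<le>
        exp (real n * (L + s * ln (real n))) * exp (real n * (M + t * ln (real n)))"
      by (intro mult_mono) auto
    then show ?case by (simp add: norm_mult flip: exp_add) (simp add: algebra_simps)
  qed
  then show ?thesis unfolding factorial_growth_def by blast
qed

lemma factorial_growth_power: "factorial_growth (\<lambda>n. z ^ n) 0"
proof -
  \<comment> \<open>Taking \<open>L = norm z\<close> instead of \<open>ln (norm z)\<close> covers
    \<open>z = 0\<close> as well.\<close>
  have "norm z \<le> exp (norm z)"
    using exp_ge_add_one_self[of "norm z"] by linarith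
  then have "norm (z ^ n) \<le> exp (real n * (norm z + 0 * ln (real n)))" for n
    by (auto simp: norm_power exp_of_nat_mult intro!: power_mono)
  then show ?thesis unfolding factorial_growth_def by (intro exI always_eventually allI)
qed

lemma factorial_growth_prod:
  assumes "finite A" "\<And>j. j \<in> A \<Longrightarrow> factorial_growth (f j) (s j)"
  shows "factorial_growth (\<lambda>n. \<Prod>j\<in>A. f j n) (\<Sum>j\<in>A. s j)"
  using assms
proof (induction A)
  case empty
  then show ?case using factorial_growth_power[of 1] by simp
next
  case (insert j A)
  then show ?case by (simp add: factorial_growth_mult)
qed

text \<open>For negative \<open>s\<close> the bracket \<open>L + s * ln n\<close> tends to minus
  infinity. Once it is below -1, the geometric series of ratio \<open>exp (-1)\<close>
  dominates.\<close>

lemma factorial_growth_summable: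
  assumes "factorial_growth f s" "s < 0"
  shows "summable (\<lambda>n. norm (f n))"
proof -
  obtain L where L: "\<forall>\<^sub>F n in sequentially. norm (f n) \<le> exp (real n * (L + s * ln (real n)))"
    using assms by (auto simp: factorial_growth_def)
  have "\<forall>\<^sub>F n in sequentially. L + s * ln (real n) \<le> -1"
    using assms(2) by real_asymp
  with L have "\<forall>\<^sub>F n in sequentially. norm (norm (f n)) \<le> exp (-1) ^ n"
  proof eventually_elim
    case (elim n)
    have "exp (real n * (L + s * ln (real n))) \<le> exp (real n * (-1))"
      using elim by (intro exp_le_cancel_iff[THEN iffD2] mult_left_mono) auto
    also have "\<dots> = exp (-1) ^ n" by (rule exp_of_nat_mult)
    finally show ?case using elim by simp
  qed
  then show ?thesis
    by (rule summable_comparison_test_ev) (simp add: summable_geometric)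
qed

section \<open>Growth exponents of Gamma and its reciprocal along progressions\<close>

text \<open>The difference equals \<open>a * n * ln (a + b / n) + b * ln (a * n + b)\<close>. Thus
  replacing \<open>a * n + b\<close> by \<open>n\<close> inside a Stirling-type bound costs only a
  geometric factor.\<close>

lemma linear_times_ln_asymp:
  fixes a b :: real
  assumes "a > 0"
  obtains M where "\<forall>\<^sub>F n in sequentially.
    \<bar>(a * real n + b) * ln (a * real n + b) - a * real n * ln (real n)\<bar> \<le> M * real n"
proof -
  have "(\<lambda>n. (a * real n + b) * ln (a * real n + b) - a * real n * ln (real n)) \<in> O(\<lambda>n. real n)"
    using assms by real_asymp
  then show ?thesis using that by (auto elim!: landau_o.bigE)
qed

lemma factorial_growth_Gamma:
  fixes \<kappa> :: real
  assumes "\<kappa> > 0"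
  shows "factorial_growth (\<lambda>n. Gamma (z + of_real \<kappa> * of_nat n)) \<kappa>"
proof -
  obtain C where C: "C > 0" "\<And>x::real. x \<ge> 1 \<Longrightarrow> Gamma x \<le> C * exp (x * ln x)"
    using Gamma_real_upper_bound by blast
  obtain M where M: "\<forall>\<^sub>F n in sequentially.
      \<bar>(\<kappa> * real n + Re z) * ln (\<kappa> * real n + Re z) - \<kappa> * real n * ln (real n)\<bar> \<le> M * real n"
    using linear_times_ln_asymp[OF assms] by blast
  have "\<forall>\<^sub>F n in sequentially. \<kappa> * real n + Re z \<ge> 1"
    using assms by real_asymp
  with M have "\<forall>\<^sub>F n in sequentially.
      norm (Gamma (z + of_real \<kappa> * of_nat n)) \<le> C * exp (real n * (M + \<kappa> * ln (real n)))"
  proof eventually_elim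
    case (elim n)
    define x where "x = \<kappa> * real n + Re z"
    have "norm (Gamma (z + of_real \<kappa> * of_nat n)) \<le> Gamma x"
      using elim norm_Gamma_le_Gamma_Re[of "z + of_real \<kappa> * of_nat n"] by (simp add: x_def add.commute)
    also have "\<dots> \<le> C * exp (x * ln x)"
      using elim by (intro C) (simp add: x_def)
    also have "\<dots> \<le> C * exp (real n * (M + \<kappa> * ln (real n)))"
      using elim C(1) by (intro mult_left_mono) (auto simp: x_def algebra_simps)
    finally show ?case .
  qed
  with C(1) show ?thesis by (rule factorial_growthI)
qed

text \<open>The sign of \<open>Re a\<close> decides where the points go: to the right the half-plane
  bound applies, to the left the reflection bound, and for \<open>Re a = 0\<close> they stay on a
  vertical line. The imaginary part grows at most linearly, so
  \<open>exp (pi * \<bar>Im z\<bar>)\<close> is geometric.\<close>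

lemma factorial_growth_rGamma:
  "factorial_growth (\<lambda>n. rGamma (a * of_nat n + b)) (- Re a)"
proof -
  define z where "z = (\<lambda>n::nat. a * of_nat n + b)"
  have Re_z: "Re (z n) = Re a * real n + Re b" for n by (simp add: z_def)
  have "\<exists>C>0. \<exists>M. \<forall>\<^sub>F n in sequentially.
      norm (rGamma (z n)) \<le> C * exp (pi * \<bar>Im (z n)\<bar> + M * real n - Re a * real n * ln (real n))"
  proof (cases "Re a" "0 :: real" rule: linorder_cases)
    case greater
    obtain C where C: "C > 0" "\<And>z. 1 \<le> Re z \<Longrightarrow>
        norm (rGamma z) \<le> C * exp (pi * \<bar>Im z\<bar> - Re z * ln (Re z) + 2 * Re z)"
      using norm_rGamma_half_plane_bound by blast
    obtain M where M: "\<forall>\<^sub>F n in sequentially.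
      \<bar>(Re a * real n + Re b) * ln (Re a * real n + Re b) - Re a * real n * ln (real n)\<bar> \<le> M * real n"
      using linear_times_ln_asymp[OF greater] by blast
    \<comment> \<open>The slope \<open>Re a + 1\<close> exceeds \<open>Re a\<close>, so it absorbs
      \<open>Re b\<close> and makes the term \<open>2 * Re z\<close> of the half-plane bound
      linear.\<close>
    have "\<forall>\<^sub>F n in sequentially. Re a * real n + Re b \<ge> 1"
      "\<forall>\<^sub>F n in sequentially. Re a * real n + Re b \<le> (Re a + 1) * real n"
      using greater by real_asymp+
    with M have "\<forall>\<^sub>F n in sequentially. norm (rGamma (z n)) \<le>
        C * exp (pi * \<bar>Im (z n)\<bar> + (M + 2 * (Re a + 1)) * real n - Re a * real n * ln (real n))"
    proof eventually_elim
      case (elim n)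
      have "norm (rGamma (z n)) \<le> C * exp (pi * \<bar>Im (z n)\<bar> - Re (z n) * ln (Re (z n)) + 2 * Re (z n))"
        using elim by (intro C) (simp add: Re_z)
      also have "\<dots> \<le> C * exp (pi * \<bar>Im (z n)\<bar> + (M + 2 * (Re a + 1)) * real n - Re a * real n * ln (real n))"
        using C(1) elim unfolding Re_z
        by (intro mult_left_mono exp_le_cancel_iff[THEN iffD2]) (auto simp: ring_distribs abs_le_iff)
      finally show ?case .
    qed
    with C(1) show ?thesis by blast
  next
    case equal
    \<comment> \<open>All real parts equal \<open>Re b\<close>, so either bound reduces to a
      constant times the exponential.\<close>
    have "\<exists>C>0. \<forall>n. norm (rGamma (z n)) \<le> C * exp (pi * \<bar>Im (z n)\<bar>)"
    proof (cases "Re b < 1")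
      case True
      then have "norm (rGamma (z n)) \<le> Gamma (1 - Re b) * exp (pi * \<bar>Im (z n)\<bar>)" for n
        using norm_rGamma_reflection_le[of "z n"] equal by (simp add: Re_z)
      then show ?thesis using True by (intro exI[of _ "Gamma (1 - Re b)"]) auto
    next
      case False
      obtain C where C: "C > 0" "\<And>z. 1 \<le> Re z \<Longrightarrow>
          norm (rGamma z) \<le> C * exp (pi * \<bar>Im z\<bar> - Re z * ln (Re z) + 2 * Re z)"
        using norm_rGamma_half_plane_bound by blast
      have "norm (rGamma (z n)) \<le> C * exp (- Re b * ln (Re b) + 2 * Re b) * exp (pi * \<bar>Im (z n)\<bar>)" for n
        using C(2)[of "z n"] False equal
        by (simp add: Re_z mult.assoc flip: exp_add) (simp add: algebra_simps)
      then show ?thesis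
        using C(1) by (intro exI[of _ "C * exp (- Re b * ln (Re b) + 2 * Re b)"]) auto
    qed
    then obtain C where "C > 0" "\<And>n. norm (rGamma (z n)) \<le> C * exp (pi * \<bar>Im (z n)\<bar>)"
      by blast
    then show ?thesis using equal by (intro exI[of _ C] conjI exI[of _ 0]) auto
  next
    case less
    obtain C where C: "C > 0" "\<And>x::real. x \<ge> 1 \<Longrightarrow> Gamma x \<le> C * exp (x * ln x)"
      using Gamma_real_upper_bound by blast
    obtain M where M: "\<forall>\<^sub>F n in sequentially. \<bar>(- Re a * real n + (1 - Re b)) *
        ln (- Re a * real n + (1 - Re b)) - (- Re a) * real n * ln (real n)\<bar> \<le> M * real n"
      using linear_times_ln_asymp[of "- Re a" "1 - Re b"] less by auto
    have "\<forall>\<^sub>F n in sequentially. Re a * real n + Re b \<le> 0"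
      using less by real_asymp
    with M have "\<forall>\<^sub>F n in sequentially. norm (rGamma (z n)) \<le>
        C * exp (pi * \<bar>Im (z n)\<bar> + M * real n - Re a * real n * ln (real n))"
    proof eventually_elim
      case (elim n)
      define x where "x = 1 - Re (z n)"
      have x: "x = - Re a * real n + (1 - Re b)" by (simp add: x_def Re_z)
      have "norm (rGamma (z n)) \<le> Gamma x * exp (pi * \<bar>Im (z n)\<bar>)"
        using elim norm_rGamma_reflection_le[of "z n"] by (simp add: Re_z x_def)
      also have "\<dots> \<le> C * exp (x * ln x) * exp (pi * \<bar>Im (z n)\<bar>)"
        using elim by (intro mult_right_mono C) (auto simp: x_def Re_z)
      also have "\<dots> = C * exp (pi * \<bar>Im (z n)\<bar> + x * ln x)"
        by (simp add: exp_add)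
      also have "\<dots> \<le> C * exp (pi * \<bar>Im (z n)\<bar> + M * real n - Re a * real n * ln (real n))"
        using C(1) elim unfolding x
        by (intro mult_left_mono exp_le_cancel_iff[THEN iffD2]) (auto simp: abs_le_iff)
      finally show ?case .
    qed
    with C(1) show ?thesis by blast
  qed
  then obtain C M where C: "C > 0" and *: "\<forall>\<^sub>F n in sequentially.
      norm (rGamma (z n)) \<le> C * exp (pi * \<bar>Im (z n)\<bar> + M * real n - Re a * real n * ln (real n))"
    by blast
  \<comment> \<open>Only here is the imaginary part estimated; \<open>n \<ge> 1\<close> turns
    \<open>\<bar>Im b\<bar>\<close> into a linear term.\<close>
  have "\<forall>\<^sub>F n in sequentially. norm (rGamma (z n)) \<le>
      C * exp (real n * ((pi * (\<bar>Im a\<bar> + \<bar>Im b\<bar>) + M) + (- Re a) * ln (real n)))"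
    using * eventually_gt_at_top[of 0]
  proof eventually_elim
    case (elim n)
    have "\<bar>Im (z n)\<bar> \<le> \<bar>Im a\<bar> * real n + \<bar>Im b\<bar> * 1"
      unfolding z_def using abs_triangle_ineq[of "Im a * real n" "Im b"] by (simp add: abs_mult)
    also have "\<dots> \<le> \<bar>Im a\<bar> * real n + \<bar>Im b\<bar> * real n"
      using elim by (intro add_left_mono mult_left_mono) auto
    finally have "pi * \<bar>Im (z n)\<bar> \<le> pi * (\<bar>Im a\<bar> * real n + \<bar>Im b\<bar> * real n)"
      by (intro mult_left_mono) auto
    then have "pi * \<bar>Im (z n)\<bar> + M * real n - Re a * real n * ln (real n) \<le>
        pi * (\<bar>Im a\<bar> * real n + \<bar>Im b\<bar> * real n) + M * real n - Re a * real n * ln (real n)"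
      by linarith
    also have "\<dots> = real n * ((pi * (\<bar>Im a\<bar> + \<bar>Im b\<bar>) + M) + (- Re a) * ln (real n))"
      by (simp add: algebra_simps)
    finally show ?case
      using elim(1) C order_trans by fastforce
  qed
  with C show ?thesis unfolding z_def by (rule factorial_growthI)
qed

subsection \<open>The complex Beta integral\<close>

text \<open>On the real line the principal logarithm is \<open>ln \<bar>r\<bar>\<close>, plus
  \<open>pi * \<i>\<close> for negative \<open>r\<close>. The resulting case distinction is
  measurable.\<close>

lemma measurable_of_real_powr [measurable]:
  fixes f :: "'a \<Rightarrow> real" and s :: complex
  assumes [measurable]: "f \<in> borel_measurable M"
  shows "(\<lambda>t. of_real (f t) powr s) \<in> borel_measurable M"
proof -
  have "of_real r powr s = (if r = 0 then 0 else
      exp (s * (of_real (ln \<bar>r\<bar>) + (if r < 0 then pi else 0) * \<i>)))" for r :: real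
    by (simp add: powr_def Ln_of_real')
  then show ?thesis by simp
qed

text \<open>The norm of the integrand is the real Beta integrand with parameters
  \<open>Re a\<close>, \<open>Re b\<close>, rescaled from the unit interval.\<close>

lemma set_integrable_Beta_complex:
  fixes a b :: complex and x :: real
  assumes a: "Re a > 0" and b: "Re b > 0" and x: "x > 0"
  shows "set_integrable lborel {0<..<x} (\<lambda>t. of_real t powr (a - 1) * of_real (x - t) powr (b - 1))"
proof -
  have "set_integrable lborel {0..1} (\<lambda>t. t powr (Re a - 1) * (1 - t) powr (Re b - 1))"
    using integrable_Beta[of "Re a" "Re b"] a b by simp
  \<comment> \<open>The argument \<open>t / x\<close> is kept in the affine form required by the
    substitution rule; the prefactor collects the powers \<open>Re a - 1\<close> and
    \<open>Re b - 1\<close> of \<open>x\<close>.\<close>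
  then have "integrable lborel (\<lambda>t. x powr (Re a + Re b - 2) *
      (indicator {0..1} (0 + 1 / x * t) *\<^sub>R ((0 + 1 / x * t) powr (Re a - 1) * (1 - (0 + 1 / x * t)) powr (Re b - 1))))"
    unfolding set_integrable_def using x
    by (intro integrable_mult_right lborel_integrable_real_affine) auto
  then show ?thesis
    unfolding set_integrable_def
  proof (rule Bochner_Integration.integrable_bound)
    show "AE t in lborel. norm (indicator {0<..<x} t *\<^sub>R (of_real t powr (a - 1) * of_real (x - t) powr (b - 1)))
      \<le> norm (x powr (Re a + Re b - 2) *
      (indicator {0..1} (0 + 1 / x * t) *\<^sub>R ((0 + 1 / x * t) powr (Re a - 1) * (1 - (0 + 1 / x * t)) powr (Re b - 1))))"
    proof (intro AE_I2)
      fix t :: real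
      have "t powr (Re a - 1) * (x - t) powr (Re b - 1) =
          x powr (Re a + Re b - 2) * ((t / x) powr (Re a - 1) * (1 - t / x) powr (Re b - 1))"
        if t: "0 < t" "t < x"
      proof -
        have "x powr (Re a + Re b - 2) = x powr (Re a - 1) * x powr (Re b - 1)"
          by (simp flip: powr_add)
        moreover have "t powr (Re a - 1) = x powr (Re a - 1) * (t / x) powr (Re a - 1)"
          using t x by (simp flip: powr_mult)
        moreover have "(x - t) powr (Re b - 1) = x powr (Re b - 1) * (1 - t / x) powr (Re b - 1)"
          using t x by (simp add: right_diff_distrib flip: powr_mult)
        ultimately show ?thesis by (simp add: mult_ac)
      qed
      then show "norm (indicator {0<..<x} t *\<^sub>R (of_real t powr (a - 1) * of_real (x - t) powr (b - 1)))
        \<le> norm (x powr (Re a + Re b - 2) *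
        (indicator {0..1} (0 + 1 / x * t) *\<^sub>R ((0 + 1 / x * t) powr (Re a - 1) * (1 - (0 + 1 / x * t)) powr (Re b - 1))))"
        by (auto simp: indicator_def norm_mult norm_powr_real_powr abs_mult field_simps
                 simp flip: of_real_diff)
    qed
    show "(\<lambda>t. indicator {0<..<x} t *\<^sub>R (of_real t powr (a - 1) * of_real (x - t) powr (b - 1)))
        \<in> borel_measurable lborel"
      by measurable
  qed
qed

text \<open>Euler's integral is moved from the Lebesgue completion to \<open>lborel\<close>, because
  Fubini is applied below on the product of two copies of \<open>lborel\<close>.\<close>

lemma Gamma_integral_lborel:
  assumes "Re z > 0"
  shows "integrable lborel (\<lambda>t. indicator {0<..} t *\<^sub>R (of_real t powr (z - 1) / of_real (exp t)))" (is ?I)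
    and "(LBINT t:{0<..}. of_real t powr (z - 1) / of_real (exp t)) = Gamma z"
proof -
  show int: ?I
    using absolutely_integrable_Gamma_integral'[OF assms] unfolding set_integrable_def
    by (subst (asm) integrable_completion) measurable
  have "(LBINT t:{0<..}. of_real t powr (z - 1) / of_real (exp t)) =
      integral {0<..} (\<lambda>t. of_real t powr (z - 1) / of_real (exp t))"
    using int by (intro set_borel_integral_eq_integral) (simp add: set_integrable_def)
  then show "(LBINT t:{0<..}. of_real t powr (z - 1) / of_real (exp t)) = Gamma z"
    using Gamma_integral_complex'[OF assms] by (simp add: has_integral_iff)
qed

text \<open>Substitute \<open>x * t\<close> for \<open>t\<close>: the two factors give
  \<open>x powr (a + b - 2)\<close> and the Jacobian gives one more \<open>x\<close>. Complex
  \<open>powr\<close> is multiplicative here because the bases are positive reals.\<close>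

lemma set_integral_Beta_scale:
  fixes a b :: complex and x :: real
  assumes x: "x > 0"
  shows "(LBINT t:{0<..<x}. of_real t powr (a - 1) * of_real (x - t) powr (b - 1)) =
    of_real x powr (a + b - 1) * (LBINT t:{0<..<1}. of_real t powr (a - 1) * of_real (1 - t) powr (b - 1))"
proof -
  have "indicator {0<..<x} (x * t) *\<^sub>R (of_real (x * t) powr (a - 1) * of_real (x - x * t) powr (b - 1)) =
      of_real x powr (a + b - 2) *
      (indicator {0<..<1} t *\<^sub>R (of_real t powr (a - 1) * of_real (1 - t) powr (b - 1)))" for t
  proof (cases "0 < t \<and> t < 1")
    case True
    have 1: "complex_of_real (x * t) powr (a - 1) = of_real x powr (a - 1) * of_real t powr (a - 1)"
      using True x by (simp add: powr_times_real)
    have 2: "complex_of_real (x * (1 - t)) powr (b - 1) = of_real x powr (b - 1) * of_real (1 - t) powr (b - 1)"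
      unfolding of_real_mult using True x by (intro powr_times_real) auto
    have 3: "complex_of_real x powr (a - 1) * of_real x powr (b - 1) = of_real x powr (a + b - 2)"
      using powr_add[of "complex_of_real x" "a - 1" "b - 1"] by (simp add: algebra_simps)
    have "of_real (x * t) powr (a - 1) * of_real (x * (1 - t)) powr (b - 1) =
        (of_real x powr (a - 1) * of_real x powr (b - 1)) *
        (of_real t powr (a - 1) * complex_of_real (1 - t) powr (b - 1))"
      by (simp only: 1 2) (simp only: mult_ac)
    moreover have "x - x * t = x * (1 - t)" by (simp add: algebra_simps)
    ultimately have "of_real (x * t) powr (a - 1) * of_real (x - x * t) powr (b - 1) =
        of_real x powr (a + b - 2) * (of_real t powr (a - 1) * complex_of_real (1 - t) powr (b - 1))"
      by (simp only: 3)
    moreover have "x * t < x" "0 < x * t" using True x by auto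
    ultimately show ?thesis
      using True by (simp only: indicator_simps greaterThanLessThan_iff simp_thms scaleR_one)
  next
    case False
    then show ?thesis using x
      by (auto simp: indicator_def zero_less_mult_iff)
  qed
  then have "(LBINT t:{0<..<x}. of_real t powr (a - 1) * of_real (x - t) powr (b - 1)) =
     of_real x * (of_real x powr (a + b - 2) * (LBINT t:{0<..<1}. of_real t powr (a - 1) * of_real (1 - t) powr (b - 1)))"
    unfolding set_lebesgue_integral_def
    using x by (subst lborel_integral_real_affine[where c = x and t = 0]) (auto simp: scaleR_conv_of_real)
  moreover have "of_real x * of_real x powr (a + b - 2) = complex_of_real x powr (a + b - 1)"
    using x powr_add[of "complex_of_real x" 1 "a + b - 2"] by (simp add: algebra_simps)
  ultimately show ?thesis by (simp flip: mult.assoc)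
qed

text \<open>Fubini for the convolution of the two Gamma integrands, extended by zero.\<close>

lemma Beta_integral_complex_unit:
  fixes a b :: complex
  assumes a: "Re a > 0" and b: "Re b > 0"
  shows "Gamma a * Gamma b =
    Gamma (a + b) * (LBINT t:{0<..<1}. of_real t powr (a - 1) * of_real (1 - t) powr (b - 1))"
proof -
  interpret lborel_pair: pair_sigma_finite "lborel :: real measure" "lborel :: real measure" ..
  define F :: "complex \<Rightarrow> complex \<Rightarrow> real \<Rightarrow> real \<Rightarrow> complex" where
    "F = (\<lambda>a b t u. indicator {0<..} t *\<^sub>R (indicator {0<..} (u - t) *\<^sub>R
        (of_real t powr (a - 1) * of_real (u - t) powr (b - 1) / of_real (exp u))))"
  define G where "G = (\<lambda>b u. indicator {0<..} u *\<^sub>R (complex_of_real u powr (b - 1) / of_real (exp u)))"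
  have G: "integrable lborel (G b)" "integral\<^sup>L lborel (G b) = Gamma b" if "Re b > 0" for b
    using Gamma_integral_lborel[OF that] by (auto simp: G_def set_lebesgue_integral_def)
  \<comment> \<open>Since \<open>exp u = exp t * exp (u - t)\<close>, \<open>F\<close> is the
    convolution integrand; \<open>- t + 1 * u\<close> fits the affine substitution rule.\<close>
  have F_eq: "F a b t u = G a t * G b (- t + 1 * u)" for a b t u
  proof -
    have "exp u = exp t * exp (- t + 1 * u)" by (simp flip: exp_add)
    then show ?thesis by (simp add: F_def G_def scaleR_conv_of_real mult_ac)
  qed
  have inner: "integrable lborel (F a b t)" "integral\<^sup>L lborel (F a b t) = G a t * Gamma b"
    if "Re b > 0" for a b t
  proof -
    have *: "integrable lborel (\<lambda>u. G b (- t + 1 * u))"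
      using G(1)[OF that] by (intro lborel_integrable_real_affine) auto
    then show "integrable lborel (F a b t)"
      unfolding F_eq by (intro integrable_mult_right)
    show "integral\<^sup>L lborel (F a b t) = G a t * Gamma b"
      unfolding F_eq using lborel_integral_real_affine[of 1 "G b" "- t"] G(2)[OF that] by simp
  qed
  \<comment> \<open>The norm is again an \<open>F\<close>, with real parameters, so the computation
    of the inner integral also yields the absolute integrability that Fubini needs.\<close>
  have norm_F: "norm (F a b t u) = Re (F (of_real (Re a)) (of_real (Re b)) t u)" for t u
  proof (cases "0 < t \<and> t < u")
    case True
    have "complex_of_real t powr (of_real (Re a) - 1) = of_real (t powr (Re a - 1))"
      using True powr_of_real[of t "Re a - 1"] by simp
    moreover have "complex_of_real (u - t) powr (of_real (Re b) - 1) = of_real ((u - t) powr (Re b - 1))"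
      using True powr_of_real[of "u - t" "Re b - 1"] by simp
    moreover have "norm (complex_of_real t powr (a - 1)) = t powr (Re a - 1)"
      using True norm_powr_real_powr[of "of_real t" "a - 1"] by simp
    moreover have "norm (complex_of_real (u - t) powr (b - 1)) = (u - t) powr (Re b - 1)"
      using True norm_powr_real_powr[of "of_real (u - t)" "b - 1"] by simp
    ultimately show ?thesis
      using True by (simp add: F_def norm_mult norm_divide del: of_real_diff)
  qed (auto simp: F_def indicator_def)
  have "integrable lborel (\<lambda>t. \<integral>u. norm (F a b t u) \<partial>lborel)"
  proof -
    have "(\<integral>u. norm (F a b t u) \<partial>lborel) = Re (G (of_real (Re a)) t * Gamma (of_real (Re b)))" for t
      using inner[of "of_real (Re b)" "of_real (Re a)" t] b by (simp add: norm_F)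
    then show ?thesis using G(1)[of "of_real (Re a)"] a by simp
  qed
  moreover have "case_prod (F a b) \<in> borel_measurable (lborel \<Otimes>\<^sub>M lborel)"
    unfolding F_def by measurable
  ultimately have int: "integrable (lborel \<Otimes>\<^sub>M lborel) (case_prod (F a b))"
    using inner(1)[OF b] by (intro lborel_pair.Fubini_integrable) auto
  \<comment> \<open>In the other order the \<open>t\<close>-integral is a Beta integral over
    \<open>(0, u)\<close>; scaling leaves the Gamma integrand of \<open>a + b\<close>.\<close>
  have outer: "(\<integral>t. F a b t u \<partial>lborel) = G (a + b) u *
      (LBINT t:{0<..<1}. of_real t powr (a - 1) * of_real (1 - t) powr (b - 1))" for u
  proof (cases "u > 0")
    case True
    have "F a b t u = indicator {0<..<u} t *\<^sub>R (of_real t powr (a - 1) * of_real (u - t) powr (b - 1)) / of_real (exp u)" for t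
      by (auto simp: F_def indicator_def)
    then have "(\<integral>t. F a b t u \<partial>lborel) =
        (LBINT t:{0<..<u}. of_real t powr (a - 1) * of_real (u - t) powr (b - 1)) / of_real (exp u)"
      by (simp add: set_lebesgue_integral_def)
    then show ?thesis
      unfolding set_integral_Beta_scale[OF True] using True by (simp add: G_def)
  next
    case False
    then have "F a b t u = 0" for t by (auto simp: F_def indicator_def)
    then show ?thesis using False by (simp add: G_def)
  qed
  from int have "(\<integral>u. (\<integral>t. F a b t u \<partial>lborel) \<partial>lborel) = (\<integral>t. (\<integral>u. F a b t u \<partial>lborel) \<partial>lborel)"
    by (rule lborel_pair.Fubini_integral)
  also have "\<dots> = Gamma a * Gamma b"
    using inner(2)[OF b] G[OF a] by simp
  finally show ?thesis
    using G[of "a + b"] a b by (simp add: outer mult_ac)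
qed

lemma Beta_integral_complex:
  fixes a b :: complex and x :: real
  assumes "Re a > 0" "Re b > 0" "x > 0"
  shows "(LBINT t:{0<..<x}. of_real t powr (a - 1) * of_real (x - t) powr (b - 1)) =
    of_real x powr (a + b - 1) * (Gamma a * Gamma b * rGamma (a + b))"
proof -
  have "a + b \<notin> \<int>\<^sub>\<le>\<^sub>0"
    using assms by (auto elim!: nonpos_Ints_cases simp: complex_eq_iff)
  then have "Gamma (a + b) * rGamma (a + b) = 1"
    by (simp add: Gamma_def rGamma_eq_zero_iff)
  then show ?thesis
    unfolding set_integral_Beta_scale[OF assms(3)] Beta_integral_complex_unit[OF assms(1,2)]
    by (simp add: mult_ac)
qed

subsection \<open>Termwise differentiation and integration\<close>

text \<open>The operator \<open>p + y * d/dy\<close> multiplies the coefficient of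
  \<open>y ^ n\<close> by \<open>p + n\<close>.\<close>

lemma power_series_euler_operator:
  fixes c :: "nat \<Rightarrow> complex"
  assumes "\<And>y. summable (\<lambda>n. c n * y ^ n)"
  shows "(\<lambda>n. (p + of_nat n) * c n * y ^ n) sums
    (p * (\<Sum>n. c n * y ^ n) + y * (\<Sum>n. diffs c n * y ^ n))"
proof -
  have "(\<lambda>n. of_nat n * c n * y ^ (n - Suc 0)) sums (\<Sum>n. diffs c n * y ^ n)"
    using assms by (intro diffs_equiv termdiff_converges_all)
  then have "(\<lambda>n. y * (of_nat n * c n * y ^ (n - Suc 0))) sums (y * (\<Sum>n. diffs c n * y ^ n))"
    by (rule sums_mult)
  \<comment> \<open>At \<open>n = 0\<close> the exponent \<open>n - Suc 0\<close> is truncated to 0,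
    but the factor \<open>of_nat n\<close> vanishes.\<close>
  moreover have "y * (of_nat n * c n * y ^ (n - Suc 0)) = of_nat n * c n * y ^ n" for n
    by (cases n) auto
  moreover have "(\<lambda>n. p * (c n * y ^ n)) sums (p * (\<Sum>n. c n * y ^ n))"
    using assms by (intro sums_mult summable_sums)
  ultimately have "(\<lambda>n. p * (c n * y ^ n) + of_nat n * c n * y ^ n) sums
    (p * (\<Sum>n. c n * y ^ n) + y * (\<Sum>n. diffs c n * y ^ n))"
    by (intro sums_add) auto
  then show ?thesis by (simp add: algebra_simps)
qed

text \<open>By the product rule, \<open>z powr p * S\<close> has derivative
  \<open>z powr (p - 1) * (p * S + z * S')\<close>. It is computed in the complex plane off the
  branch cut and then restricted to the real line.\<close>

lemma has_vector_derivative_powr_power_series: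
  fixes c :: "nat \<Rightarrow> complex"
  assumes c: "\<And>y. summable (\<lambda>n. c n * y ^ n)" and x: "x > 0"
  shows "((\<lambda>x. of_real x powr p * (\<Sum>n. c n * of_real x ^ n)) has_vector_derivative
      of_real x powr (p - 1) * (\<Sum>n. (p + of_nat n) * c n * of_real x ^ n)) (at x)"
proof -
  define z where "z = complex_of_real x"
  have "z \<notin> \<real>\<^sub>\<le>\<^sub>0" using x by (simp add: z_def)
  have "((\<lambda>z. z powr p * (\<Sum>n. c n * z ^ n)) has_field_derivative
      z powr p * (\<Sum>n. diffs c n * z ^ n) + p * z powr (p - 1) * (\<Sum>n. c n * z ^ n)) (at z)"
    using \<open>z \<notin> \<real>\<^sub>\<le>\<^sub>0\<close>
    by (intro DERIV_mult' has_field_derivative_powr termdiffs_strong_converges_everywhere c)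
  moreover have "z powr p = z powr (p - 1) * z"
    using x powr_add[of z "p - 1" 1] by (simp add: z_def)
  moreover have "(\<Sum>n. (p + of_nat n) * c n * z ^ n) =
      p * (\<Sum>n. c n * z ^ n) + z * (\<Sum>n. diffs c n * z ^ n)"
    using power_series_euler_operator[OF c] by (rule sums_unique[symmetric])
  ultimately have "((\<lambda>z. z powr p * (\<Sum>n. c n * z ^ n)) has_field_derivative
      z powr (p - 1) * (\<Sum>n. (p + of_nat n) * c n * z ^ n)) (at z)"
    by (simp add: algebra_simps)
  then show ?thesis
    unfolding z_def by (rule has_vector_derivative_real_field)
qed

text \<open>Differentiation reproduces the shape with \<open>p - 1\<close> for \<open>p\<close>,
  because \<open>(p + n) * rGamma (p + n + 1) = rGamma (p + n)\<close> holds even at the poles of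
  Gamma. Hence \<open>g\<close> and \<open>p\<close> vary in the induction.\<close>

lemma iterated_vector_derivative_powr_rGamma_series:
  fixes d :: "nat \<Rightarrow> complex" and g :: "real \<Rightarrow> complex"
  assumes "\<And>y. summable (\<lambda>n. d n * rGamma (p + of_nat n + 1) * y ^ n)"
    and "\<And>x. x > 0 \<Longrightarrow> g x = of_real x powr p * (\<Sum>n. d n * rGamma (p + of_nat n + 1) * of_real x ^ n)"
    and "x > 0"
  shows "((\<lambda>g x. vector_derivative g (at x)) ^^ k) g x =
    of_real x powr (p - of_nat k) * (\<Sum>n. d n * rGamma (p - of_nat k + of_nat n + 1) * of_real x ^ n)"
  using assms
proof (induction k arbitrary: g p)
  case 0
  then show ?case by simp
next
  case (Suc k)
  have step: "(p + of_nat n) * (d n * rGamma (p + of_nat n + 1)) = d n * rGamma (p - 1 + of_nat n + 1)" for n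
    using rGamma_plus1[of "p + of_nat n"] by (simp add: mult_ac)
  have "vector_derivative g (at x) =
      of_real x powr (p - 1) * (\<Sum>n. d n * rGamma (p - 1 + of_nat n + 1) * of_real x ^ n)" if x: "x > 0" for x
  proof (rule vector_derivative_at)
    have "((\<lambda>x. of_real x powr p * (\<Sum>n. d n * rGamma (p + of_nat n + 1) * of_real x ^ n))
        has_vector_derivative
      of_real x powr (p - 1) * (\<Sum>n. d n * rGamma (p - 1 + of_nat n + 1) * of_real x ^ n)) (at x)"
      using has_vector_derivative_powr_power_series[OF Suc.prems(1) x, of p] unfolding step .
    then show "(g has_vector_derivative
      of_real x powr (p - 1) * (\<Sum>n. d n * rGamma (p - 1 + of_nat n + 1) * of_real x ^ n)) (at x)"
      \<comment> \<open>The formula for \<open>g\<close> is known only for positive arguments, but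
        these form an open set.\<close>
      by (rule has_vector_derivative_transform_within_open[of _ _ _ "{0<..}"])
         (use x Suc.prems(2) in auto)
  qed
  moreover have "summable (\<lambda>n. d n * rGamma (p - 1 + of_nat n + 1) * y ^ n)" for y
    using power_series_euler_operator[OF Suc.prems(1), THEN sums_summable, of p y] unfolding step .
  ultimately have "((\<lambda>g x. vector_derivative g (at x)) ^^ k) (\<lambda>x. vector_derivative g (at x)) x =
    of_real x powr (p - 1 - of_nat k) *
    (\<Sum>n. d n * rGamma (p - 1 - of_nat k + of_nat n + 1) * of_real x ^ n)"
    using Suc.prems(3) by (intro Suc.IH)
  then show ?case
    \<comment> \<open>The derivative is peeled off innermost, so that the induction hypothesis
      applies to the derivative of \<open>g\<close>.\<close>
    by (simp add: funpow_Suc_right del: funpow.simps) (simp add: algebra_simps)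
qed

section \<open>Fractional integral of a power times a power series\<close>

text \<open>Each term is a Beta integral with parameters \<open>\<delta> + n\<close> and
  \<open>\<mu>\<close>. The exchange of sum and integral is dominated by
  \<open>norm (a n) * x ^ n * norm (h t)\<close>, as \<open>t < x\<close> on the range of
  integration.\<close>

lemma RL_integral_powr_power_series:
  fixes a :: "nat \<Rightarrow> complex"
  assumes \<delta>: "Re \<delta> > 0" and \<mu>: "Re \<mu> > 0" and x: "x > 0"
    and a: "summable (\<lambda>n. norm (a n) * x ^ n)"
  shows "RL_integral \<mu> (\<lambda>t. of_real t powr (\<delta> - 1) * (\<Sum>n. a n * of_real t ^ n)) x =
    of_real x powr (\<delta> + \<mu> - 1) *
    (\<Sum>n. a n * Gamma (\<delta> + of_nat n) * rGamma (\<delta> + \<mu> + of_nat n) * of_real x ^ n)"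
proof -
  define h where "h = (\<lambda>t. indicator {0<..<x} t *\<^sub>R
      (of_real t powr (\<delta> - 1) * complex_of_real (x - t) powr (\<mu> - 1)))"
  define f where "f = (\<lambda>n t. a n * (h t * of_real t ^ n))"
  have h: "integrable lborel h"
    using set_integrable_Beta_complex[OF \<delta> \<mu> x] by (simp add: h_def set_integrable_def)
  have h_power: "h t * of_real t ^ n = indicator {0<..<x} t *\<^sub>R
      (of_real t powr (\<delta> + of_nat n - 1) * complex_of_real (x - t) powr (\<mu> - 1))" for n t
  proof (cases "0 < t \<and> t < x")
    case True
    then have "complex_of_real t powr (\<delta> + of_nat n - 1) = of_real t powr (\<delta> - 1) * of_real t ^ n"
      using powr_add[of "complex_of_real t" "\<delta> - 1" "of_nat n"]
      by (simp add: powr_nat' algebra_simps)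
    then show ?thesis by (simp add: h_def mult_ac)
  qed (auto simp: h_def)
  have f_int: "integrable lborel (f n)" for n
    unfolding f_def h_power
    using set_integrable_Beta_complex[of "\<delta> + of_nat n" \<mu> x] \<delta> \<mu> x
    by (intro integrable_mult_right) (simp add: set_integrable_def)
  have norm_f: "norm (f n t) \<le> norm (a n) * x ^ n * norm (h t)" for n t
  proof (cases "0 < t \<and> t < x")
    case True
    then have "norm (a n) * (norm (h t) * t ^ n) \<le> norm (a n) * (norm (h t) * x ^ n)"
      by (intro mult_left_mono power_mono) auto
    then show ?thesis using True by (simp add: f_def norm_mult norm_power mult_ac)
  qed (auto simp: f_def h_def)
  have 1: "AE t in lborel. summable (\<lambda>n. norm (f n t))"
  proof (intro AE_I2)
    show "summable (\<lambda>n. norm (f n t))" for t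
      by (rule summable_comparison_test'[OF summable_mult2[OF a, of "norm (h t)"]]) (simp add: norm_f)
  qed
  have 2: "summable (\<lambda>n. \<integral>t. norm (f n t) \<partial>lborel)"
  proof (rule summable_comparison_test')
    show "summable (\<lambda>n. norm (a n) * x ^ n * (\<integral>t. norm (h t) \<partial>lborel))"
      by (rule summable_mult2[OF a])
    show "norm (\<integral>t. norm (f n t) \<partial>lborel) \<le> norm (a n) * x ^ n * (\<integral>t. norm (h t) \<partial>lborel)" for n
    proof -
      have "(\<integral>t. norm (f n t) \<partial>lborel) \<le> (\<integral>t. norm (a n) * x ^ n * norm (h t) \<partial>lborel)"
        by (intro integral_mono integrable_norm integrable_mult_right f_int h norm_f)
      then show ?thesis by simp
    qed
  qed
  have integral_f: "integral\<^sup>L lborel (f n) = of_real x powr (\<delta> + \<mu> - 1) * (Gamma \<mu> *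
      (a n * Gamma (\<delta> + of_nat n) * rGamma (\<delta> + \<mu> + of_nat n) * of_real x ^ n))" for n
  proof -
    have "integral\<^sup>L lborel (f n) = a n * (LBINT t:{0<..<x}.
        of_real t powr (\<delta> + of_nat n - 1) * complex_of_real (x - t) powr (\<mu> - 1))"
      unfolding f_def h_power set_lebesgue_integral_def by (rule integral_mult_right_zero)
    also have "\<dots> = a n * (of_real x powr (\<delta> + of_nat n + \<mu> - 1) *
        (Gamma (\<delta> + of_nat n) * Gamma \<mu> * rGamma (\<delta> + of_nat n + \<mu>)))"
      using \<delta> \<mu> x by (subst Beta_integral_complex) auto
    also have "complex_of_real x powr (\<delta> + of_nat n + \<mu> - 1) = of_real x powr (\<delta> + \<mu> - 1) * of_real x ^ n"
      using x powr_add[of "complex_of_real x" "\<delta> + \<mu> - 1" "of_nat n"]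
      by (simp add: powr_nat' algebra_simps)
    finally show ?thesis by (simp add: mult_ac add_ac)
  qed
  have "indicator {0<..<x} t *\<^sub>R (of_real t powr (\<delta> - 1) * (\<Sum>n. a n * of_real t ^ n) /
      complex_of_real (x - t) powr (1 - \<mu>)) = (\<Sum>n. f n t)" for t
  proof (cases "0 < t \<and> t < x")
    case True
    have "summable (\<lambda>n. a n * of_real t ^ n)"
    proof (rule summable_comparison_test'[OF a])
      show "norm (a n * of_real t ^ n) \<le> norm (a n) * x ^ n" for n
        using True by (auto simp: norm_mult norm_power intro!: mult_left_mono power_mono)
    qed
    then have "(\<Sum>n. h t * (a n * of_real t ^ n)) = h t * (\<Sum>n. a n * of_real t ^ n)"
      by (rule suminf_mult)
    moreover have "complex_of_real (x - t) powr (\<mu> - 1) = inverse (of_real (x - t) powr (1 - \<mu>))"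
      using powr_minus[of "complex_of_real (x - t)" "1 - \<mu>"] by simp
    ultimately show ?thesis
      using True by (simp add: f_def h_def mult_ac divide_inverse del: of_real_diff)
  qed (auto simp: f_def h_def)
  then have "RL_integral \<mu> (\<lambda>t. of_real t powr (\<delta> - 1) * (\<Sum>n. a n * of_real t ^ n)) x =
      1 / Gamma \<mu> * (\<integral>t. (\<Sum>n. f n t) \<partial>lebesgue)"
    unfolding RL_integral_def set_lebesgue_integral_def by simp
  \<comment> \<open>The fractional integral is defined with \<open>lebesgue\<close>; the sum is
    Borel measurable, so its integral agrees with that over \<open>lborel\<close>.\<close>
  also have "(\<integral>t. (\<Sum>n. f n t) \<partial>lebesgue) = (\<integral>t. (\<Sum>n. f n t) \<partial>lborel)"
    using integrable_suminf[OF f_int 1 2] by (intro integral_completion) auto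
  also have "\<dots> = (\<Sum>n. integral\<^sup>L lborel (f n))"
    by (rule integral_suminf[OF f_int 1 2])
  also have "\<dots> = of_real x powr (\<delta> + \<mu> - 1) * (Gamma \<mu> *
      (\<Sum>n. a n * Gamma (\<delta> + of_nat n) * rGamma (\<delta> + \<mu> + of_nat n) * of_real x ^ n))"
  proof -
    define C where "C = complex_of_real x powr (\<delta> + \<mu> - 1) * Gamma \<mu>"
    define S where "S = (\<lambda>n. a n * Gamma (\<delta> + of_nat n) * rGamma (\<delta> + \<mu> + of_nat n) * of_real x ^ n)"
    have eq: "integral\<^sup>L lborel (f n) = C * S n" for n
      unfolding integral_f C_def S_def by (simp only: mult.assoc)
    \<comment> \<open>Summability of \<open>S\<close> is read off from that of the integrals
      \<open>C * S n\<close>, which requires a nonzero factor.\<close>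
    have "C \<noteq> 0"
      using x \<mu> by (auto simp: C_def Gamma_eq_zero_iff elim!: nonpos_Ints_cases)
    moreover have "summable (\<lambda>n. C * S n)"
      using summable_integral[OF f_int 1 2] by (simp only: eq)
    ultimately have "summable S" using summable_mult_D by blast
    then have "(\<Sum>n. C * S n) = C * (\<Sum>n. S n)" by (rule suminf_mult)
    then show ?thesis
      unfolding eq by (simp only: C_def S_def mult.assoc)
  qed
  finally show ?thesis
    using \<mu> by (auto simp: Gamma_eq_zero_iff elim!: nonpos_Ints_cases)
qed

subsection \<open>The fractional derivative of the Bessel function\<close>

theorem theorem3:
  fixes m :: nat and \<alpha> \<beta> :: "nat \<Rightarrow> complex" and \<gamma> b c \<nu> \<delta> :: complex and \<kappa> x :: real
  assumes "\<kappa> > 0"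
    and "(\<Sum>j=1..m. Re (\<alpha> j)) > max 0 (\<kappa> - 1)"
    and "\<And>j. j \<in> {1..m} \<Longrightarrow> Re (\<beta> j) > 0"
    and "Re \<gamma> > 0"
    and "Re \<nu> > 0"
    and "Re \<delta> > 0"
    and "x > 0"
  shows "RL_derivative \<nu>
      (\<lambda>t. of_real t powr (\<delta> - 1) * multiindex_bessel m \<alpha> \<beta> (of_real \<kappa>) b \<gamma> c (of_real t)) x
    = of_real x powr (\<delta> - \<nu> - 1) / Gamma \<gamma>
      * fox_wright [(\<gamma>, of_real \<kappa>), (\<delta>, 1)]
          (map (\<lambda>j. (\<beta> j + (b + 1) / 2, \<alpha> j)) [1..<Suc m] @ [(\<delta> - \<nu>, 1)])
          (c * of_real x)"
proof -
  define P where "P = (\<lambda>n::nat. \<Prod>j=1..m. rGamma (\<alpha> j * of_nat n + (\<beta> j + (b + 1) / 2)))"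
  \<comment> \<open>\<open>A n / Gamma \<gamma>\<close> are the coefficients of the Bessel series.
    The factor \<open>1 / n!\<close> is written as \<open>rGamma (1 * of_nat n + 1)\<close> so that
    the growth lemma applies with slope 1.\<close>
  define A where "A = (\<lambda>n::nat. Gamma (\<gamma> + of_real \<kappa> * of_nat n) * P n * rGamma (1 * of_nat n + 1) * c ^ n)"
  define D where "D = (\<lambda>n::nat. A n * Gamma (\<delta> + of_real 1 * of_nat n))"
  \<comment> \<open>The growth exponent of \<open>A\<close>: \<open>\<kappa>\<close> from the
    numerator, minus the real parts from \<open>P\<close>, minus 1 from
    \<open>1 / n!\<close>.\<close>
  define s where "s = \<kappa> - (\<Sum>j=1..m. Re (\<alpha> j)) - 1"
  have s: "s < 0" using assms(2) by (simp add: s_def)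
  have P: "factorial_growth P (\<Sum>j=1..m. - Re (\<alpha> j))"
    unfolding P_def by (intro factorial_growth_prod factorial_growth_rGamma) auto
  have A: "factorial_growth A s"
  proof -
    have "factorial_growth A (\<kappa> + (\<Sum>j=1..m. - Re (\<alpha> j)) + - Re 1 + 0)"
      unfolding A_def
      by (intro factorial_growth_mult factorial_growth_Gamma factorial_growth_rGamma
            factorial_growth_power P assms(1))
    then show ?thesis by (simp add: s_def sum_negf)
  qed
  have D: "factorial_growth D (s + 1)"
    unfolding D_def by (intro factorial_growth_mult A factorial_growth_Gamma) simp
  have summable_A: "summable (\<lambda>n. norm (A n * y ^ n))" for y
    using factorial_growth_summable[OF factorial_growth_mult[OF A factorial_growth_power[of y]]] s
    by simp
  \<comment> \<open>\<open>D\<close> alone has exponent \<open>s + 1\<close>; one more reciprocal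
    Gamma factor restores \<open>s < 0\<close>. The offset \<open>r\<close> will be
    \<open>\<delta> + \<mu>\<close> before and \<open>\<delta> - \<nu>\<close> after
    differentiation.\<close>
  have summable_D: "summable (\<lambda>n. D n * rGamma (1 * of_nat n + r) * y ^ n)" for r y
  proof -
    have "factorial_growth (\<lambda>n. D n * rGamma (1 * of_nat n + r) * y ^ n) (s + 1 + - Re 1 + 0)"
      by (intro factorial_growth_mult D factorial_growth_rGamma factorial_growth_power)
    then show ?thesis using s by (intro summable_norm_cancel[OF factorial_growth_summable]) auto
  qed

  define N where "N = nat \<lfloor>Re \<nu>\<rfloor>"
  define \<mu> where "\<mu> = 1 - \<nu> + of_int \<lfloor>Re \<nu>\<rfloor>"
  \<comment> \<open>As \<open>Re \<nu> > 0\<close>, the floor is nonnegative and \<open>nat\<close>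
    does not truncate.\<close>
  have N: "of_int \<lfloor>Re \<nu>\<rfloor> = (of_nat N :: complex)"
    using assms(5) by (simp add: N_def)
  \<comment> \<open>\<open>Re \<mu>\<close> is 1 minus the fractional part of
    \<open>Re \<nu>\<close>.\<close>
  have \<mu>: "Re \<mu> > 0" unfolding \<mu>_def by (simp add: algebra_simps) linarith
  define f where "f = (\<lambda>t::real. of_real t powr (\<delta> - 1) *
    multiindex_bessel m \<alpha> \<beta> (of_real \<kappa>) b \<gamma> c (of_real t))"
  have f: "f = (\<lambda>t. of_real t powr (\<delta> - 1) * (\<Sum>n. A n / Gamma \<gamma> * of_real t ^ n))"
  proof -
    have "multiindex_bessel m \<alpha> \<beta> (of_real \<kappa>) b \<gamma> c z = (\<Sum>n. A n / Gamma \<gamma> * z ^ n)" for z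
      unfolding multiindex_bessel_def gen_pochhammer_def A_def P_def
      by (simp add: rGamma_inverse_Gamma Gamma_fact add_ac field_simps)
    then show ?thesis by (simp add: f_def)
  qed
  \<comment> \<open>The argument \<open>\<delta> + \<mu> + n\<close> is split as
    \<open>p + n + 1\<close> with \<open>p = \<delta> + \<mu> - 1\<close>, the form used for
    iterated differentiation.\<close>
  have "RL_integral \<mu> f y = of_real y powr (\<delta> + \<mu> - 1) *
      (\<Sum>n. D n / Gamma \<gamma> * rGamma ((\<delta> + \<mu> - 1) + of_nat n + 1) * of_real y ^ n)" if "y > 0" for y
  proof -
    have "summable (\<lambda>n. norm (A n / Gamma \<gamma>) * y ^ n)"
      using summable_divide[OF summable_A[of "of_real y"], of "norm (Gamma \<gamma>)"] that
      by (simp add: norm_mult norm_divide norm_power)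
    from RL_integral_powr_power_series[OF assms(6) \<mu> that this]
    show ?thesis unfolding f by (simp add: D_def algebra_simps)
  qed
  moreover have "summable (\<lambda>n. D n / Gamma \<gamma> * rGamma ((\<delta> + \<mu> - 1) + of_nat n + 1) * y ^ n)" for y
    using summable_divide[OF summable_D[of "\<delta> + \<mu>" y], of "Gamma \<gamma>"] by (simp add: algebra_simps)
  ultimately have "RL_derivative \<nu> f x = of_real x powr (\<delta> + \<mu> - 1 - of_nat (N + 1)) *
      (\<Sum>n. D n / Gamma \<gamma> * rGamma (\<delta> + \<mu> - 1 - of_nat (N + 1) + of_nat n + 1) * of_real x ^ n)"
    unfolding RL_derivative_def N_def[symmetric] \<mu>_def[symmetric]
    using assms(7) by (intro iterated_vector_derivative_powr_rGamma_series)
  \<comment> \<open>The order \<open>\<mu>\<close> was chosen so that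
    \<open>\<mu> - (N + 1) = - \<nu>\<close>.\<close>
  also have "\<delta> + \<mu> - 1 - of_nat (N + 1) = \<delta> - \<nu> - 1"
    by (simp add: \<mu>_def N)
  also have "(\<Sum>n. D n / Gamma \<gamma> * rGamma (\<delta> - \<nu> - 1 + of_nat n + 1) * of_real x ^ n) =
      (\<Sum>n. D n * rGamma (1 * of_nat n + (\<delta> - \<nu>)) * of_real x ^ n) / Gamma \<gamma>"
    using suminf_divide[OF summable_D[of "\<delta> - \<nu>" "of_real x"], of "Gamma \<gamma>"]
    by (simp add: algebra_simps)
  also have "(\<Sum>n. D n * rGamma (1 * of_nat n + (\<delta> - \<nu>)) * of_real x ^ n) =
      fox_wright [(\<gamma>, of_real \<kappa>), (\<delta>, 1)]
        (map (\<lambda>j. (\<beta> j + (b + 1) / 2, \<alpha> j)) [1..<Suc m] @ [(\<delta> - \<nu>, 1)]) (c * of_real x)"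
  proof -
    have "(\<Prod>(b, B)\<leftarrow>map (\<lambda>j. (\<beta> j + (b + 1) / 2, \<alpha> j)) [1..<Suc m]. rGamma (b + B * of_nat n)) = P n"
      for n :: nat
      unfolding P_def map_map o_def case_prod_conv
      by (subst prod.distinct_set_conv_list [symmetric])
         (auto simp: add_ac atLeastLessThanSuc_atLeastAtMost simp del: upt_Suc)
    moreover have "rGamma (1 * of_nat n + 1) = 1 / (fact n :: complex)" for n
      by (simp add: rGamma_inverse_Gamma Gamma_fact add_ac field_simps)
    ultimately show ?thesis
      unfolding fox_wright_def D_def A_def
      by (simp only: map_append prod_list.append power_mult_distrib list.map prod_list.Cons
            prod_list.Nil case_prod_conv)
         (simp add: mult_ac add_ac)
  qed
  finally show ?thesis by (simp add: f_def)
qed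

end
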